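(* Let $l, m \ge 1$ be integers and let $\mathfrak{B} : S^{m-1} \to S^{m-1}$ be a polynomial stochastic operator (PSO) associated with a stochastic hypermatrix $\mathcal{P} = (P_{i_1\cdots i_l,k})_{i_1,\dots,i_l,k\in I_m}$, such that $\mathfrak{B}(\mathbf{e}_i) = \mathbf{e}_i$ for all $i \in I_m$. Then the following statements are equivalent: (i) $\mathfrak{B}$ is orthogonal preserving; (ii) $\mathfrak{B}$ is surjective; (iii) $\mathfrak{B}$ satisfies all of the following conditions $(1),(2),\dots,(l)$: condition $(1)$ is $\mathfrak{B}^{-1}(\{\mathbf{e}_i\}) = \{\mathbf{e}_i\}$ for any $i \in I_m$; and, for each $k \in \{2,\dots,l\}$, condition $(k)$ is $$\mathfrak{B}^{-1}\bigl(\mathrm{int}\,\Gamma_{\mathbf{e}_{i_1}\cdots \mathbf{e}_{i_k}}\bigr) = \mathrm{int}\,\Gamma_{\mathbf{e}_{i_1}\cdots \mathbf{e}_{i_k}} \quad \text{for any } i_1,\dots,i_k \in I_m .$$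
   Context: $I_m = \{1,\dots,m\}$; $\{\mathbf{e}_i\}_{i\in I_m}$ is the standard basis of $\mathbb{R}^m$; the simplex is $S^{m-1} = \{\mathbf{x}\in\mathbb{R}^m : x_i \ge 0 \ \forall i \in I_m,\ \sum_{i=1}^m x_i = 1\}$, and its elements are called stochastic vectors. Stochastic hypermatrix: a real array $\mathcal{P} = (P_{i_1\cdots i_l,k})_{i_1,\dots,i_l,k\in I_m}$ such that for all $i_1,\dots,i_l\in I_m$ the vector $P_{i_1\cdots i_l,\bullet} = (P_{i_1\cdots i_l,1},\dots,P_{i_1\cdots i_l,m})$ belongs to $S^{m-1}$. Standing assumption: $P_{i_1\cdots i_l,\bullet}$ is invariant under every permutation of the indices $i_1,\dots,i_l$. The associated polynomial stochastic operator (PSO) $\mathfrak{B}:S^{m-1}\to S^{m-1}$ is $$\mathfrak{B}(\mathbf{x}) = \sum_{i_1=1}^m\cdots\sum_{i_l=1}^m x_{i_1}\cdots x_{i_l}\, P_{i_1\cdots i_l,\bullet}.$$ For $\mathbf{x}\in S^{m-1}$, $\mathrm{supp}(\mathbf{x}) = \{i\in I_m : x_i\neq 0\}$. Vectors $\mathbf{x},\mathbf{y}\in S^{m-1}$ are orthogonal, $\mathbf{x}\perp\mathbf{y}$, if $\mathrm{supp}(\mathbf{x})\cap\mathrm{supp}(\mathbf{y})=\emptyset$. A PSO $\mathfrak{B}$ is orthogonal preserving if for all $\mathbf{x},\mathbf{y}\in S^{m-1}$, $\mathbf{x}\perp\mathbf{y}$ implies $\mathfrak{B}(\mathbf{x})\perp\mathfrak{B}(\mathbf{y})$.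 For $A\subset I_m$, $\Gamma_A = \mathrm{conv}\{\mathbf{e}_i\}_{i\in A}$ and $\mathrm{int}\,\Gamma_A = \{\mathbf{x}\in\Gamma_A : x_i>0\ \forall i\in A\}$. We write $\Gamma_{\mathbf{e}_{i_1}\cdots\mathbf{e}_{i_k}} = \mathrm{conv}\{\mathbf{e}_{i_1},\dots,\mathbf{e}_{i_k}\}$, i.e. $\Gamma_A$ with $A=\{i_1,\dots,i_k\}$. $\mathfrak{B}^{-1}(\cdot)$ denotes the preimage in $S^{m-1}$. *)

theory Defs
  imports "HOL-Analysis.Analysis" "HOL-Combinatorics.Permutations"
begin

definition stochastic_simplex :: "(real ^ 'm) set" where
  "stochastic_simplex = {x. (\<forall>i. 0 \<le> x $ i) \<and> (\<Sum>i\<in>UNIV. x $ i) = 1}"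

text \<open>The multi-index \<open>(i\<^sub>1, \<dots>, i\<^sub>l)\<close> is a list of length \<open>l\<close>, and \<open>P is $ k\<close> is the entry
  with indices \<open>is\<close> and \<open>k\<close>, so that \<open>P is\<close> is the row vector. The values of \<open>P\<close> at lists of
  any other length are irrelevant. The permutation invariance, a standing assumption on
  hypermatrices, is part of the definition.\<close>

definition stochastic_hypermatrix :: "nat \<Rightarrow> ('m list \<Rightarrow> real ^ 'm) \<Rightarrow> bool" where
  "stochastic_hypermatrix l P \<longleftrightarrow>
     (\<forall>is. length is = l \<longrightarrow> P is \<in> stochastic_simplex) \<and>
     (\<forall>is p. length is = l \<and> p permutes {..<l} \<longrightarrow> P (permute_list p is) = P is)"

definition pso :: "nat \<Rightarrow> ('m list \<Rightarrow> real ^ 'm) \<Rightarrow> real ^ 'm \<Rightarrow> real ^ 'm" where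
  "pso l P x = (\<Sum>is\<in>{is. length is = l}. (\<Prod>j<l. x $ (is ! j)) *\<^sub>R P is)"

definition supp :: "real ^ 'm \<Rightarrow> 'm set" where
  "supp x = {i. x $ i \<noteq> 0}"

definition orth :: "real ^ 'm \<Rightarrow> real ^ 'm \<Rightarrow> bool" where
  "orth x y \<longleftrightarrow> supp x \<inter> supp y = {}"

definition orthogonal_preserving :: "(real ^ 'm \<Rightarrow> real ^ 'm) \<Rightarrow> bool" where
  "orthogonal_preserving B \<longleftrightarrow>
     (\<forall>x\<in>stochastic_simplex. \<forall>y\<in>stochastic_simplex. orth x y \<longrightarrow> orth (B x) (B y))"

definition face :: "'m set \<Rightarrow> (real ^ 'm) set" where
  "face A = convex hull ((\<lambda>i. axis i 1) ` A)"

definition int_face :: "'m set \<Rightarrow> (real ^ 'm) set" where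
  "int_face A = {x \<in> face A. \<forall>i\<in>A. 0 < x $ i}"

text \<open>An operator on the simplex is represented by a function on the whole space, so preimages
  have to be cut down to the simplex.\<close>

definition simplex_preimage :: "(real ^ 'm \<Rightarrow> real ^ 'm) \<Rightarrow> (real ^ 'm) set \<Rightarrow> (real ^ 'm) set" where
  "simplex_preimage B T = {x \<in> stochastic_simplex. B x \<in> T}"

end

theory Submission
  imports Defs
begin

text \<open>The support of \<open>B x\<close> depends only on \<open>A = supp x\<close>: it is the union \<open>S A\<close> of the supports of the
  rows \<open>P is\<close> with indices in \<open>A\<close>. As every vertex is fixed, \<open>A \<subseteq> S A\<close>, and each of the three
  statements turns out to be equivalent to \<open>S A = A\<close> for all \<open>A\<close>. For orthogonality preservation,
  apply it to \<open>A\<close> and its complement. Surjectivity provides for every nonempty \<open>A\<close> some \<open>D \<subseteq> A\<close> with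
  \<open>S D = A\<close>, and induction on \<open>A\<close> forces \<open>D = A\<close>. Conversely, a continuous self-map of the simplex with
  \<open>supp (f x) \<subseteq> supp x\<close> is surjective by Brouwer's theorem: for a target \<open>y\<close>, add to \<open>x\<close> the positive part
  of \<open>y - f x\<close> and normalise. At a fixed point not solving \<open>f x = y\<close>, \<open>supp x\<close> would be the set where
  \<open>y\<close> exceeds \<open>f x\<close>, although \<open>f x\<close> has total mass \<open>1\<close> on it.\<close>

section \<open>Supports and faces of the simplex\<close>

lemma supp_iff: "i \<in> supp x \<longleftrightarrow> x $ i \<noteq> 0"
  by (simp add: supp_def)

lemma simplexD:
  assumes "x \<in> stochastic_simplex"
  shows "0 \<le> x $ i" "(\<Sum>i\<in>UNIV. x $ i) = 1"
  using assms by (auto simp: stochastic_simplex_def)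

lemma axis_in_simplex: "axis i 1 \<in> stochastic_simplex"
  by (auto simp: stochastic_simplex_def axis_def)

lemma supp_axis: "supp (axis i 1 :: real ^ 'm) = {i}"
  by (auto simp: supp_def axis_def)

lemma supp_nonempty: "x \<in> stochastic_simplex \<Longrightarrow> supp x \<noteq> {}"
  using simplexD(2)[of x] by (fastforce simp: supp_def)

lemma sum_supp:
  assumes "x \<in> stochastic_simplex" "supp x \<subseteq> A"
  shows "(\<Sum>i\<in>A. x $ i) = 1"
proof -
  have "(\<Sum>i\<in>A. x $ i) = (\<Sum>i\<in>UNIV. x $ i)"
    using assms(2) by (intro sum.mono_neutral_left) (auto simp: supp_def)
  then show ?thesis
    using simplexD(2)[OF assms(1)] by simp
qed

lemma simplex_supp_singleton:
  fixes x :: "real ^ 'm::finite"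
  assumes "x \<in> stochastic_simplex" "supp x = {i}"
  shows "x = axis i 1"
  using sum_supp[of x "{i}"] assms by (auto simp: vec_eq_iff axis_def supp_def)

lemma convex_simplex: "convex (stochastic_simplex :: (real ^ 'm::finite) set)"
  by (auto simp: convex_def stochastic_simplex_def sum.distrib simp flip: sum_distrib_left)

lemma compact_simplex: "compact (stochastic_simplex :: (real ^ 'm::finite) set)"
proof -
  have "norm x \<le> 1" if "x \<in> stochastic_simplex" for x :: "real ^ 'm"
    using norm_le_l1_cart[of x] simplexD[OF that] by simp
  then have "bounded (stochastic_simplex :: (real ^ 'm) set)"
    by (auto simp: bounded_iff)
  moreover have "closed (stochastic_simplex :: (real ^ 'm) set)"
    unfolding stochastic_simplex_def
    by (intro closed_Collect_conj closed_Collect_all closed_Collect_le closed_Collect_eq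
        continuous_intros)
  ultimately show ?thesis
    by (simp add: compact_eq_bounded_closed)
qed

text \<open>The right-hand side is convex and contains the vertices, hence the hull; conversely
  \<open>x\<close> is the convex combination of the vertices with its own coordinates as
  weights.\<close>

lemma face_eq: "face A = {x \<in> stochastic_simplex. supp x \<subseteq> (A :: 'm::finite set)}"
proof
  have "convex {x \<in> stochastic_simplex. supp x \<subseteq> A}"
  proof (rule convexI)
    fix x y :: "real ^ 'm" and u v :: real
    assume *: "x \<in> {x \<in> stochastic_simplex. supp x \<subseteq> A}" "y \<in> {x \<in> stochastic_simplex. supp x \<subseteq> A}"
      "0 \<le> u" "0 \<le> v" "u + v = 1"
    then show "u *\<^sub>R x + v *\<^sub>R y \<in> {x \<in> stochastic_simplex. supp x \<subseteq> A}"
      using convexD[OF convex_simplex, of x y u v] by (fastforce simp: supp_def)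
  qed
  then show "face A \<subseteq> {x \<in> stochastic_simplex. supp x \<subseteq> A}"
    unfolding face_def
    by (intro hull_minimal) (auto simp: axis_in_simplex supp_axis)
  show "{x \<in> stochastic_simplex. supp x \<subseteq> A} \<subseteq> face A"
  proof clarify
    fix x :: "real ^ 'm" assume x: "x \<in> stochastic_simplex" "supp x \<subseteq> A"
    have "(\<Sum>i\<in>A. x $ i *\<^sub>R axis i 1) \<in> face A"
      unfolding face_def
      by (rule convex_sum) (use x in \<open>auto simp: simplexD sum_supp intro: hull_inc\<close>)
    moreover have "(\<Sum>i\<in>A. x $ i *\<^sub>R axis i 1) = x"
      using x(2) by (auto simp: vec_eq_iff axis_def supp_def if_distrib cong: if_cong)
    ultimately show "x \<in> face A"
      by simp
  qed
qed

text \<open>Turns the preimage conditions into statements about supports alone.\<close>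

lemma int_face_eq: "int_face A = {x \<in> stochastic_simplex. supp x = (A :: 'm::finite set)}"
  unfolding int_face_def face_eq supp_def
  by (auto simp: simplexD less_le)

text \<open>The barycentre of the face is a witness. Facts about supports of points thereby become
  facts about all nonempty index sets.\<close>

lemma int_face_nonempty:
  fixes A :: "'m::finite set"
  assumes "A \<noteq> {}"
  obtains x where "x \<in> stochastic_simplex" "supp x = A"
proof
  let ?x = "\<chi> i. if i \<in> A then 1 / real (card A) else 0"
  have "card A > 0"
    using assms by (simp add: card_gt_0_iff)
  then show "?x \<in> stochastic_simplex" "supp ?x = A"
    by (auto simp: stochastic_simplex_def supp_def sum.If_cases)
qed

section \<open>Surjectivity of self-maps that do not enlarge supports\<close>

lemma surjective_if_supp_subset:
  fixes f :: "real ^ 'm::finite \<Rightarrow> real ^ 'm"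
  assumes cont: "continuous_on stochastic_simplex f"
    and f: "\<And>x. x \<in> stochastic_simplex \<Longrightarrow> f x \<in> stochastic_simplex"
    and supp: "\<And>x. x \<in> stochastic_simplex \<Longrightarrow> supp (f x) \<subseteq> supp x"
  shows "f ` stochastic_simplex = stochastic_simplex"
proof
  show "f ` stochastic_simplex \<subseteq> stochastic_simplex"
    using f by blast
  show "stochastic_simplex \<subseteq> f ` stochastic_simplex"
  proof
    fix y :: "real ^ 'm" assume y: "y \<in> stochastic_simplex"
    define p where "p x i = max 0 (y $ i - f x $ i)" for x i
    define s where "s x = (\<Sum>i\<in>UNIV. p x i)" for x
    define g where "g x = (\<chi> i. (x $ i + p x i) / (1 + s x))" for x
    have p_nonneg: "p x i \<ge> 0" for x i
      by (simp add: p_def)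
    then have s_nonneg: "s x \<ge> 0" for x
      by (simp add: s_def sum_nonneg)
    then have s_pos: "1 + s x > 0" for x
      by (simp add: add_pos_nonneg)
    have cont_s: "continuous_on stochastic_simplex s"
      unfolding s_def p_def by (intro continuous_intros cont)
    have "continuous_on stochastic_simplex g"
      unfolding g_def p_def
      by (intro continuous_intros cont cont_s ballI) (use s_pos in \<open>simp add: less_imp_neq[symmetric]\<close>)
    moreover have "g \<in> stochastic_simplex \<rightarrow> stochastic_simplex"
    proof
      fix x :: "real ^ 'm" assume x: "x \<in> stochastic_simplex"
      have "(\<Sum>i\<in>UNIV. g x $ i) = (\<Sum>i\<in>UNIV. x $ i + p x i) / (1 + s x)"
        by (simp add: g_def sum_divide_distrib)
      also have "\<dots> = 1"
        using s_pos[of x] by (simp add: sum.distrib simplexD(2)[OF x] s_def)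
      finally show "g x \<in> stochastic_simplex"
        using s_pos[of x] p_nonneg simplexD(1)[OF x]
        by (auto simp: stochastic_simplex_def g_def intro!: divide_nonneg_pos add_nonneg_nonneg)
    qed
    ultimately obtain x where x: "x \<in> stochastic_simplex" "g x = x"
      using brouwer[OF compact_simplex convex_simplex] axis_in_simplex
      by (metis empty_iff)
    \<comment> \<open>The fixed-point equation with its denominator cleared: unless
      \<open>s x = 0\<close>, the support of \<open>x\<close> is exactly where \<open>p x\<close> is
      positive.\<close>
    have fixed: "x $ i * s x = p x i" for i
    proof -
      have "(x $ i + p x i) / (1 + s x) = x $ i"
        using arg_cong[OF x(2), of "\<lambda>v. v $ i"] by (simp add: g_def)
      then show ?thesis
        using s_pos[of x] by (simp add: field_simps)
    qed
    have "s x = 0"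
    proof (rule ccontr)
      assume "s x \<noteq> 0"
      then have *: "y $ i > f x $ i" if "i \<in> supp x" for i
      proof -
        have "p x i \<noteq> 0"
          using that \<open>s x \<noteq> 0\<close> by (simp add: supp_iff flip: fixed)
        then show ?thesis
          by (auto simp: p_def max_def split: if_splits)
      qed
      have "(\<Sum>i\<in>supp x. f x $ i) < (\<Sum>i\<in>supp x. y $ i)"
        using * supp_nonempty[OF x(1)] by (intro sum_strict_mono) auto
      also have "\<dots> \<le> (\<Sum>i\<in>UNIV. y $ i)"
        using simplexD(1)[OF y] by (intro sum_mono2) auto
      \<comment> \<open>Both sums equal 1: \<open>f x\<close> has no mass outside
        \<open>supp x\<close>.\<close>
      also have "\<dots> = (\<Sum>i\<in>supp x. f x $ i)"
        using simplexD(2)[OF y] sum_supp[OF f supp] x(1) by simp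
      finally show False
        by simp
    qed
    \<comment> \<open>With \<open>s x = 0\<close> every \<open>p x i\<close> vanishes; equal total
      masses then turn the coordinatewise inequality into equality.\<close>
    then have le: "y $ i \<le> f x $ i" for i
      using fixed[of i] by (simp add: p_def max_def split: if_splits)
    have "(\<Sum>i\<in>UNIV. f x $ i - y $ i) = 0"
      using simplexD(2)[OF y] simplexD(2)[OF f[OF x(1)]] by (simp add: sum_subtractf)
    then have "f x $ i - y $ i = 0" for i
      using le by (subst (asm) sum_nonneg_eq_0_iff) auto
    then have "y = f x"
      by (simp add: vec_eq_iff)
    then show "y \<in> f ` stochastic_simplex"
      using x(1) by blast
  qed
qed

section \<open>Polynomial stochastic operators and their action on supports\<close>

lemma finite_lists_of_length: "finite {is :: 'm::finite list. length is = n}"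
  using finite_lists_length_eq[of "UNIV :: 'm set" n] by simp

text \<open>Expansion of a power of a sum, by splitting off the head of each list. It shows that the
  weights of the rows in \<open>pso\<close> add up to 1 on the simplex.\<close>

lemma sum_lists_prod:
  fixes f :: "'m::finite \<Rightarrow> real"
  shows "(\<Sum>is\<in>{is. length is = n}. \<Prod>j<n. f (is ! j)) = (\<Sum>i\<in>UNIV. f i) ^ n"
proof (induction n)
  case (Suc n)
  have lists: "{is :: 'm list. length is = Suc n} = (\<lambda>(i, is). i # is) ` (UNIV \<times> {is. length is = n})"
    by (auto simp: length_Suc_conv image_iff)
  have "(\<Sum>is\<in>{is. length is = Suc n}. \<Prod>j<Suc n. f (is ! j)) =
      (\<Sum>(i, is)\<in>UNIV \<times> {is. length is = n}. f i * (\<Prod>j<n. f (is ! j)))"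
    unfolding lists
    by (subst sum.reindex) (auto simp: inj_on_def prod.lessThan_Suc_shift split_def simp del: prod.lessThan_Suc)
  also have "\<dots> = (\<Sum>i\<in>UNIV. f i) * (\<Sum>is\<in>{is. length is = n}. \<Prod>j<n. f (is ! j))"
    by (simp add: sum.cartesian_product[symmetric] sum_product)
  finally show ?case
    using Suc by simp
qed simp

lemma pso_component:
  "pso l P x $ k = (\<Sum>is\<in>{is. length is = l}. (\<Prod>j<l. x $ (is ! j)) * P is $ k)"
  by (simp add: pso_def)

lemma continuous_on_pso: "continuous_on S (pso l P)"
  unfolding pso_def by (intro continuous_intros)

lemma hypermatrix_row:
  "stochastic_hypermatrix l P \<Longrightarrow> length is = l \<Longrightarrow> P is \<in> stochastic_simplex"
  by (simp add: stochastic_hypermatrix_def)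

lemma pso_in_simplex:
  fixes P :: "'m::finite list \<Rightarrow> real ^ 'm"
  assumes P: "stochastic_hypermatrix l P" and x: "x \<in> stochastic_simplex"
  shows "pso l P x \<in> stochastic_simplex"
proof -
  have "(\<Sum>k\<in>UNIV. pso l P x $ k) =
      (\<Sum>is\<in>{is. length is = l}. (\<Prod>j<l. x $ (is ! j)) * (\<Sum>k\<in>UNIV. P is $ k))"
    unfolding pso_component sum_distrib_left by (rule sum.swap)
  also have "\<dots> = (\<Sum>is\<in>{is. length is = l}. \<Prod>j<l. x $ (is ! j))"
    using hypermatrix_row[OF P] by (intro sum.cong) (auto simp: simplexD(2))
  also have "\<dots> = 1"
    by (simp add: sum_lists_prod simplexD(2)[OF x])
  finally show ?thesis
    using simplexD(1)[OF x] simplexD(1)[OF hypermatrix_row[OF P]]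
    by (auto simp: stochastic_simplex_def pso_component intro!: sum_nonneg mult_nonneg_nonneg prod_nonneg)
qed

definition supp_image :: "nat \<Rightarrow> ('m list \<Rightarrow> real ^ 'm) \<Rightarrow> 'm set \<Rightarrow> 'm set" where
  "supp_image l P A = (\<Union>is\<in>{is. length is = l \<and> set is \<subseteq> A}. supp (P is))"

text \<open>All terms are nonnegative, so nothing cancels, and the weight of a row is nonzero
  exactly when all its indices lie in \<open>supp x\<close>.\<close>

lemma supp_pso:
  fixes P :: "'m::finite list \<Rightarrow> real ^ 'm"
  assumes P: "stochastic_hypermatrix l P" and x: "x \<in> stochastic_simplex"
  shows "supp (pso l P x) = supp_image l P (supp x)"
proof -
  have nonneg: "0 \<le> (\<Prod>j<l. x $ (is ! j)) * P is $ k" if "length is = l" for "is" k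
    using simplexD(1)[OF x] simplexD(1)[OF hypermatrix_row[OF P that]]
    by (intro mult_nonneg_nonneg prod_nonneg) auto
  have "pso l P x $ k = 0 \<longleftrightarrow> (\<forall>is\<in>{is. length is = l}. (\<Prod>j<l. x $ (is ! j)) * P is $ k = 0)" for k
    unfolding pso_component
    by (rule sum_nonneg_eq_0_iff) (use nonneg finite_lists_of_length in auto)
  moreover have "(\<Prod>j<l. x $ (is ! j)) \<noteq> 0 \<longleftrightarrow> set is \<subseteq> supp x" if "length is = l" for "is"
  proof -
    have "(\<Prod>j<l. x $ (is ! j)) \<noteq> 0 \<longleftrightarrow> (\<forall>j<l. is ! j \<in> supp x)"
      by (simp add: supp_iff Ball_def)
    also have "\<dots> \<longleftrightarrow> set is \<subseteq> supp x"
      using that by (simp add: subset_code(1) all_set_conv_all_nth)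
    finally show ?thesis .
  qed
  ultimately show ?thesis
    by (auto simp: supp_image_def supp_iff set_eq_iff) blast+
qed

lemma supp_image_mono: "A \<subseteq> D \<Longrightarrow> supp_image l P A \<subseteq> supp_image l P D"
  unfolding supp_image_def by blast

theorem theorem3p3:
  fixes l :: nat and P :: "'m::finite list \<Rightarrow> real ^ 'm" and B :: "real ^ 'm \<Rightarrow> real ^ 'm"
  assumes "l \<ge> 1"
    and "stochastic_hypermatrix l P"
    and "\<And>x. x \<in> stochastic_simplex \<Longrightarrow> B x = pso l P x"
    and "\<And>i. B (axis i 1) = axis i 1"
  shows "(orthogonal_preserving B \<longleftrightarrow> B ` stochastic_simplex = stochastic_simplex) \<and>
    (B ` stochastic_simplex = stochastic_simplex \<longleftrightarrow>
      (\<forall>i. simplex_preimage B {axis i 1} = {axis i 1}) \<and>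
      (\<forall>k\<in>{2..l}. \<forall>is. length is = k \<longrightarrow>
        simplex_preimage B (int_face (set is)) = int_face (set is)))"
proof -
  let ?S = "supp_image l P"
  have B_simplex: "B x \<in> stochastic_simplex" if "x \<in> stochastic_simplex" for x
    using pso_in_simplex[OF assms(2) that] assms(3)[OF that] by simp
  have supp_B: "supp (B x) = ?S (supp x)" if "x \<in> stochastic_simplex" for x
    using supp_pso[OF assms(2) that] assms(3)[OF that] by simp
  have vertex: "?S {i} = {i}" for i
    using supp_B[OF axis_in_simplex, of i] by (simp add: assms(4) supp_axis)
  have extensive: "A \<subseteq> ?S A" for A
    using supp_image_mono[of "{_}" A l P] vertex by blast
  \<comment> \<open>For \<open>l = 0\<close> the empty list would contribute a row.\<close>
  have S_empty: "?S {} = {}"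
    using assms(1) by (auto simp: supp_image_def)
  let ?Q = "\<forall>A. ?S A = A"

  have orth: "orthogonal_preserving B \<longleftrightarrow> ?Q"
  proof
    assume op: "orthogonal_preserving B"
    show ?Q
    proof
      fix A
      show "?S A = A"
      \<comment> \<open>Only if \<open>A\<close> and its complement are both nonempty are they
        supports of points of the simplex.\<close>
      proof (cases "A = {} \<or> A = UNIV")
        case True
        then show ?thesis
          using S_empty extensive[of UNIV] by auto
      next
        case False
        then have "A \<noteq> {}" "- A \<noteq> {}"
          by auto
        then obtain x y where xy: "x \<in> stochastic_simplex" "supp x = A"
            "y \<in> stochastic_simplex" "supp y = - A"
          by (metis int_face_nonempty)
        then have "orth (B x) (B y)"
          using op by (auto simp: orthogonal_preserving_def orth_def)
        then have "?S A \<inter> ?S (- A) = {}"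
          using supp_B xy by (metis orth_def)
        then show ?thesis
          using extensive[of A] extensive[of "- A"] by blast
      qed
    qed
  next
    assume ?Q
    then show "orthogonal_preserving B"
      using supp_B by (simp add: orthogonal_preserving_def orth_def)
  qed

  have surj: "B ` stochastic_simplex = stochastic_simplex \<longleftrightarrow> ?Q"
  proof
    assume surj: "B ` stochastic_simplex = stochastic_simplex"
    have "?S A = A" for A
    proof (induction A rule: measure_induct_rule[where f = card])
      case (less A)
      show ?case
      proof (cases "A = {}")
        case False
        then obtain y where y: "y \<in> stochastic_simplex" "supp y = A"
          by (rule int_face_nonempty)
        then obtain x where x: "x \<in> stochastic_simplex" "B x = y"
          using surj by (metis imageE)
        let ?D = "supp x"
        have D: "?S ?D = A"
          using supp_B[OF x(1)] x(2) y(2) by simp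
        then have "?D \<subseteq> A"
          using extensive[of ?D] by simp
        \<comment> \<open>If \<open>?D\<close> were a proper subset, the induction hypothesis would
          give \<open>?S ?D = ?D\<close>, contradicting \<open>?S ?D = A\<close>.\<close>
        then have "?D = A"
          using less[of ?D] D psubset_card_mono[of A ?D] by auto
        then show ?thesis
          using D by simp
      qed (simp add: S_empty)
    qed
    then show ?Q ..
  next
    assume ?Q
    moreover have "continuous_on stochastic_simplex B"
      using continuous_on_pso assms(3) by (metis (no_types, lifting) continuous_on_cong)
    ultimately show "B ` stochastic_simplex = stochastic_simplex"
      using B_simplex supp_B by (intro surjective_if_supp_subset) auto
  qed

  have preimages: "((\<forall>i. simplex_preimage B {axis i 1} = {axis i 1}) \<and>
      (\<forall>k\<in>{2..l}. \<forall>is. length is = k \<longrightarrow>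
        simplex_preimage B (int_face (set is)) = int_face (set is))) \<longleftrightarrow> ?Q" (is "?L \<longleftrightarrow> _")
  proof
    assume L: ?L
    have row: "supp (P is) \<subseteq> set is" if len: "length is = l" for "is"
    \<comment> \<open>For \<open>l = 1\<close> the range \<open>{2..l}\<close> is empty, and the
      rows are those of the fixed vertices.\<close>
    proof (cases "l = 1")
      case True
      then obtain i where "is = [i]"
        using len by (auto simp: length_Suc_conv)
      then show ?thesis
        using vertex[of i] len by (fastforce simp: supp_image_def)
    next
      case False
      then have "l \<in> {2..l}"
        using assms(1) by simp
      \<comment> \<open>Condition \<open>k = l\<close> suffices for every row, since the list
        \<open>is\<close> may have repeated entries.\<close>
      then have "simplex_preimage B (int_face (set is)) = int_face (set is)"
        using L len by blast
      moreover have "set is \<noteq> {}"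
        using len assms(1) by auto
      then obtain x where x: "x \<in> stochastic_simplex" "supp x = set is"
        by (rule int_face_nonempty)
      ultimately have "supp (B x) = set is"
        unfolding simplex_preimage_def int_face_eq by blast
      then show ?thesis
        using supp_B[OF x(1)] x(2) len by (auto simp: supp_image_def)
    qed
    then have "?S A \<subseteq> A" for A
      by (fastforce simp: supp_image_def)
    then show ?Q
      using extensive by blast
  next
    assume ?Q
    then have eq: "supp (B x) = supp x" if "x \<in> stochastic_simplex" for x
      using supp_B that by simp
    then have "simplex_preimage B (int_face A) = int_face A" for A
      using B_simplex by (auto simp: simplex_preimage_def int_face_eq)
    \<comment> \<open>Makes condition (1) the singleton case of the preceding equality.\<close>
    moreover have "int_face {i} = {axis i 1}" for i :: 'm
      using simplex_supp_singleton by (auto simp: int_face_eq axis_in_simplex supp_axis)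
    ultimately show ?L
      by metis
  qed

  show ?thesis
    using orth surj preimages by simp
qed

end
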